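(* Let $a<b$ be real numbers, let $n\ge 1$, let $\gamma:[a,b]\to\mathbb{R}^n$ be an analytic curve in $\mathbb{R}^n$, and let $N$ be a natural number. For $t\in[a,b]$ set $$\Gamma(t)=\big(\gamma(t),\gamma'(t),\gamma''(t),\ldots,\gamma^{(N)}(t)\big)\in\mathbb{R}^{n(N+1)},$$ and let $J=\Gamma([a,b])$. Regard $\mathbb{R}^{n(N+1)}$ as the set of points of $\mathbb{C}^{n(N+1)}$ with real coordinates, let $\Omega\subset\mathbb{C}^{n(N+1)}$ be an open set containing $J$, and let $F:\Omega\to\mathbb{C}$ be a holomorphic function such that $F(J)\subset(0,+\infty)$. Define $$S(t)=\int_a^t F(\Gamma(u))\,du,\qquad a\le t\le b,$$ which is a continuous strictly increasing bijection from $[a,b]$ onto a compact interval $[A,B]\subset\mathbb{R}$, with inverse $S^{-1}:[A,B]\to[a,b]$. Then $\delta=\gamma\circ S^{-1}:[A,B]\to\mathbb{R}^n$ is an analytic curve in $\mathbb{R}^n$.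
   Context: Definition (analytic curve in $\mathbb{R}^n$). Let $I\subset\mathbb{R}$ be a nonempty interval of arbitrary type which is not a singleton. A map $\gamma:I\to\mathbb{R}^n$ is analytic (an analytic curve) if: (1) for every $t\in I$ the derivative $\gamma'(t)$ exists in $\mathbb{R}^n$ (one-sided at endpoints belonging to $I$) and $\gamma'(t)\neq 0$; (2) for every $t_0\in I$ there exist $\delta_{t_0}>0$ and a sequence $a_m\in\mathbb{R}^n$ such that $\sum_{m=0}^\infty (t-t_0)^m a_m$ converges for $t\in(t_0-\delta_{t_0},t_0+\delta_{t_0})$ and $\gamma(t)=\sum_{m=0}^\infty (t-t_0)^m a_m$ for all $t\in I\cap(t_0-\delta_{t_0},t_0+\delta_{t_0})$. *)

theory Defs
  imports "HOL-Analysis.Analysis"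
begin

definition analytic_curve_on :: "real set \<Rightarrow> (real \<Rightarrow> real ^ 'n) \<Rightarrow> bool" where
  "analytic_curve_on I \<gamma> \<longleftrightarrow>
     is_interval I \<and> I \<noteq> {} \<and> \<not> (\<exists>x. I = {x}) \<and>
     (\<forall>t\<in>I. \<exists>v. (\<gamma> has_vector_derivative v) (at t within I) \<and> v \<noteq> 0) \<and>
     (\<forall>t0\<in>I. \<exists>d>0. \<exists>c :: nat \<Rightarrow> real ^ 'n.
        (\<forall>t\<in>{t0 - d<..<t0 + d}. summable (\<lambda>m. (t - t0) ^ m *\<^sub>R c m)) \<and>
        (\<forall>t\<in>I \<inter> {t0 - d<..<t0 + d}. \<gamma> t = (\<Sum>m. (t - t0) ^ m *\<^sub>R c m)))"

text \<open>The \<open>k\<close>-th derivative of \<open>f\<close> relative to \<open>I\<close>; at endpoints belonging to an interval \<open>I\<close>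
  all derivatives are one-sided.\<close>

primrec nth_vderiv_on :: "real set \<Rightarrow> nat \<Rightarrow> (real \<Rightarrow> real ^ 'n) \<Rightarrow> real \<Rightarrow> real ^ 'n" where
  "nth_vderiv_on I 0 f = f"
| "nth_vderiv_on I (Suc k) f = (\<lambda>t. vector_derivative (nth_vderiv_on I k f) (at t within I))"

definition complexify :: "real ^ 'k \<Rightarrow> complex ^ 'k" where
  "complexify x = (\<chi> i. complex_of_real (x $ i))"

text \<open>Holomorphy in several complex variables, as Frechet differentiability over the complex
  numbers: \<open>has_derivative\<close> only gives a real-linear \<open>L\<close>, so homogeneity over the complex
  scalars is required in addition.  Intended for open \<open>\<Omega>\<close>.\<close>

definition holomorphic_several_on :: "(complex ^ 'k \<Rightarrow> complex) \<Rightarrow> (complex ^ 'k) set \<Rightarrow> bool" where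
  "holomorphic_several_on F \<Omega> \<longleftrightarrow>
     (\<forall>z\<in>\<Omega>. \<exists>L. (F has_derivative L) (at z) \<and> (\<forall>c v. L (c *s v) = c * L v))"

text \<open>The real coordinate space of dimension \<open>n (N + 1)\<close> is \<open>real ^ ('m \<times> 'n)\<close>, where the finite type \<open>'m\<close> indexes the
  blocks through a bijection \<open>ord\<close> from \<open>'m\<close> onto \<open>{..N}\<close>: the block with index \<open>i\<close> holds the
  derivative of order \<open>ord i\<close>.\<close>

definition jet :: "('m::finite \<Rightarrow> nat) \<Rightarrow> real set \<Rightarrow> (real \<Rightarrow> real ^ 'n) \<Rightarrow> real \<Rightarrow> real ^ ('m \<times> 'n)" where
  "jet ord I \<gamma> t = (\<chi> p. nth_vderiv_on I (ord (fst p)) \<gamma> t $ snd p)"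

end

theory Submission
  imports Defs "HOL-Complex_Analysis.Conformal_Mappings"
begin

text \<open>
  Near a point \<open>t\<^sub>0\<close> the coordinates of \<open>\<gamma>\<close>, and hence of \<open>\<Gamma>\<close>, extend to holomorphic functions of
  one complex variable, so \<open>F \<circ> \<Gamma>\<close> extends to a holomorphic function \<open>H\<close> with \<open>H t\<^sub>0 > 0\<close>. A primitive of
  \<open>H\<close> extends \<open>S\<close> and has a holomorphic local inverse \<open>Q\<close>, which extends \<open>S\<^sup>-\<^sup>1\<close>. Composing the extension of
  \<open>\<gamma>\<close> with \<open>Q\<close> and taking real parts of the Taylor coefficients at \<open>S t\<^sub>0\<close> gives the power series of
  \<open>\<gamma> \<circ> S\<^sup>-\<^sup>1\<close>. Its derivative is \<open>\<gamma>' / (F \<circ> \<Gamma>)\<close>, which does not vanish.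
\<close>

section \<open>Componentwise differentiation and summation of vectors\<close>

lemma has_derivative_vec_lambda:
  fixes f :: "'i::finite \<Rightarrow> 'a::real_normed_vector \<Rightarrow> 'b::euclidean_space"
  assumes "\<And>i. (f i has_derivative f' i) (at x within S)"
  shows "((\<lambda>y. \<chi> i. f i y) has_derivative (\<lambda>h. \<chi> i. f' i h)) (at x within S)"
proof (subst has_derivative_componentwise_within, rule ballI)
  fix u :: "'b ^ 'i" assume "u \<in> Basis"
  then obtain i v where u: "u = axis i v"
    by (auto simp: Basis_vec_def)
  show "((\<lambda>y. (\<chi> i. f i y) \<bullet> u) has_derivative (\<lambda>h. (\<chi> i. f' i h) \<bullet> u)) (at x within S)"
    unfolding u inner_axis vec_lambda_beta by (rule has_derivative_inner_left[OF assms])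
qed

lemma has_vector_derivative_vec_lambda:
  fixes f :: "'i::finite \<Rightarrow> real \<Rightarrow> 'b::euclidean_space"
  assumes "\<And>i. (f i has_vector_derivative f' i) (at x within S)"
  shows "((\<lambda>y. \<chi> i. f i y) has_vector_derivative (\<chi> i. f' i)) (at x within S)"
proof -
  have "((\<lambda>y. \<chi> i. f i y) has_derivative (\<lambda>h. \<chi> i. h *\<^sub>R f' i)) (at x within S)"
    using assms by (intro has_derivative_vec_lambda) (simp add: has_vector_derivative_def)
  moreover have "(\<lambda>h. \<chi> i. h *\<^sub>R f' i) = (\<lambda>h. h *\<^sub>R (\<chi> i. f' i))"
    by (auto simp: vec_eq_iff)
  ultimately show ?thesis
    by (simp add: has_vector_derivative_def)
qed

lemma sums_vecI:
  fixes f :: "nat \<Rightarrow> 'b::real_normed_vector ^ 'i"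
  assumes "\<And>i. (\<lambda>m. f m $ i) sums (l $ i)"
  shows "f sums l"
  using assms unfolding sums_def by (intro vec_tendstoI) (simp add: sum_component)

section \<open>Holomorphic extension, composition and local inversion\<close>

lemma holomorphic_on_of_real_power_series:
  fixes c :: "nat \<Rightarrow> real"
  assumes "\<And>t. t \<in> {t0 - d<..<t0 + d} \<Longrightarrow> summable (\<lambda>m. (t - t0) ^ m * c m)"
  shows "(\<lambda>z. \<Sum>m. complex_of_real (c m) * (z - of_real t0) ^ m) holomorphic_on ball (of_real t0) d"
proof (rule power_series_holomorphic, rule summable_sums)
  fix w assume w: "w \<in> ball (complex_of_real t0) d"
  \<comment> \<open>A radius strictly between \<open>norm (w - of_real t0)\<close> and
    \<open>d\<close>: the real series converges at \<open>t0 + \<rho>\<close>, and this forces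
    convergence at every complex point closer to \<open>t0\<close> than \<open>\<rho>\<close>, in
    particular at \<open>w\<close>.\<close>
  define \<rho> where "\<rho> = (norm (w - of_real t0) + d) / 2"
  have "norm (w - of_real t0) < d" "0 \<le> norm (w - of_real t0)"
    using w by (auto simp: dist_norm norm_minus_commute)
  then have less: "norm (w - of_real t0) < \<rho>" "\<rho> < d" and "0 \<le> \<rho>"
    by (auto simp: \<rho>_def simp del: norm_ge_zero)
  have "summable (\<lambda>m. \<rho> ^ m * c m)"
    using assms[of "t0 + \<rho>"] less \<open>0 \<le> \<rho>\<close> by simp
  then have "summable (\<lambda>m. complex_of_real (\<rho> ^ m * c m))"
    by (rule summable_of_real)
  then have "summable (\<lambda>m. complex_of_real (c m) * complex_of_real \<rho> ^ m)"
    by (simp add: mult.commute)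
  then show "summable (\<lambda>m. complex_of_real (c m) * (w - of_real t0) ^ m)"
    by (rule powser_inside) (use less \<open>0 \<le> \<rho>\<close> in simp)
qed

text \<open>The series at \<open>t0\<close> converges on a two-sided real neighbourhood, even when
  \<open>t0\<close> is an endpoint of \<open>I\<close>. Inserting a complex variable into the series
  of each coordinate therefore gives a holomorphic function on a full disc.\<close>

lemma analytic_curve_on_complex_extension:
  assumes "analytic_curve_on I \<gamma>" "t0 \<in> I"
  obtains r g where "r > 0" "\<And>i. g i holomorphic_on ball (of_real t0) r"
    "\<And>i t. t \<in> I \<Longrightarrow> of_real t \<in> ball (complex_of_real t0) r \<Longrightarrow> g i (of_real t) = of_real (\<gamma> t $ i)"
proof -
  have "\<exists>d>0. \<exists>c. (\<forall>t\<in>{t0 - d<..<t0 + d}. summable (\<lambda>m. (t - t0) ^ m *\<^sub>R c m)) \<and>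
      (\<forall>t\<in>I \<inter> {t0 - d<..<t0 + d}. \<gamma> t = (\<Sum>m. (t - t0) ^ m *\<^sub>R c m))"
    using assms unfolding analytic_curve_on_def by simp
  then obtain d c where d: "d > 0"
    and summ: "\<forall>t\<in>{t0 - d<..<t0 + d}. summable (\<lambda>m. (t - t0) ^ m *\<^sub>R c m)"
    and eq: "\<forall>t\<in>I \<inter> {t0 - d<..<t0 + d}. \<gamma> t = (\<Sum>m. (t - t0) ^ m *\<^sub>R c m)"
    by (elim exE conjE) (rule that)
  define g where "g i z = (\<Sum>m. complex_of_real (c m $ i) * (z - of_real t0) ^ m)" for i z
  show thesis
  proof
    show "g i holomorphic_on ball (of_real t0) d" for i
      unfolding g_def
    proof (rule holomorphic_on_of_real_power_series)
      fix t assume "t \<in> {t0 - d<..<t0 + d}"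
      from summable_vec_nth[OF bspec[OF summ this], of i]
      show "summable (\<lambda>m. (t - t0) ^ m * c m $ i)" by simp
    qed
    fix i t assume t: "t \<in> I" "of_real t \<in> ball (complex_of_real t0) d"
    then have t': "t \<in> {t0 - d<..<t0 + d}"
      by (auto simp: dist_real_def)
    have "(\<lambda>m. (t - t0) ^ m *\<^sub>R c m) sums \<gamma> t"
      using summable_sums[OF bspec[OF summ t']] bspec[OF eq IntI[OF t(1) t']] by simp
    from sums_of_real[OF sums_vec_nth[OF this, of i], where 'a = complex]
    have "(\<lambda>m. complex_of_real (c m $ i) * (of_real t - of_real t0) ^ m) sums of_real (\<gamma> t $ i)"
      by (simp add: mult.commute)
    then show "g i (of_real t) = of_real (\<gamma> t $ i)"
      unfolding g_def by (simp add: sums_iff)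
  qed (fact d)
qed

text \<open>Induction on \<open>k\<close>: a complex derivative is also the derivative along the
  real interval, one-sided at an endpoint. As \<open>a < b\<close>, derivatives within
  \<open>{a..b}\<close> are unique, so \<open>vector_derivative\<close> returns this value.\<close>

lemma higher_deriv_eq_nth_vderiv_on:
  fixes \<gamma> :: "real \<Rightarrow> real ^ 'n"
  assumes "a < b" "open U" and hol: "\<And>i. g i holomorphic_on U"
    and eq: "\<And>i t. t \<in> {a..b} \<Longrightarrow> of_real t \<in> U \<Longrightarrow> g i (of_real t) = of_real (\<gamma> t $ i)"
    and "t \<in> {a..b}" "of_real t \<in> U"
  shows "(deriv ^^ k) (g i) (of_real t) = of_real (nth_vderiv_on {a..b} k \<gamma> t $ i)"
  using assms(5,6)
proof (induction k arbitrary: t i)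
  case 0
  then show ?case by (simp add: eq)
next
  case (Suc k)
  \<comment> \<open>Differentiating the induction hypothesis takes its validity near
    \<open>t\<close>, not only at \<open>t\<close>; a real ball around \<open>t\<close> that embeds
    into \<open>U\<close> provides this.\<close>
  have "open (complex_of_real -` U)"
    by (intro open_vimage continuous_intros assms)
  then obtain e where e: "e > 0" "ball t e \<subseteq> complex_of_real -` U"
    using Suc.prems by (meson openE vimageI)
  have IH: "(deriv ^^ k) (g i) (of_real t') = of_real (nth_vderiv_on {a..b} k \<gamma> t' $ i)"
    if "t' \<in> {a..b}" "dist t' t < e" for t' i
    using that e Suc.IH[of t' i] by (auto simp: dist_commute subset_iff)
  let ?v = "\<lambda>i. (deriv ^^ Suc k) (g i) (of_real t)"
  have der: "((\<lambda>t. complex_of_real (nth_vderiv_on {a..b} k \<gamma> t $ i)) has_vector_derivative ?v i) (at t within {a..b})"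
    for i
  proof (rule has_vector_derivative_transform_within)
    show "((\<lambda>x. (deriv ^^ k) (g i) (of_real x)) has_vector_derivative ?v i) (at t within {a..b})"
      by (intro has_vector_derivative_real_field has_field_derivative_higher_deriv[OF hol])
         (use assms Suc.prems in auto)
  qed (use e Suc.prems IH in auto)
  have der_Re: "((\<lambda>t. nth_vderiv_on {a..b} k \<gamma> t $ i) has_vector_derivative Re (?v i)) (at t within {a..b})" for i
    using bounded_linear.has_vector_derivative[OF bounded_linear_Re der[of i]] by simp
  \<comment> \<open>The function differentiated in \<open>der\<close> is real-valued, so its
    imaginary part is constantly 0 and uniqueness of the derivative applies.\<close>
  have "Im (?v i) = 0"
  proof -
    have "((\<lambda>t. 0::real) has_vector_derivative Im (?v i)) (at t within {a..b})"
      using bounded_linear.has_vector_derivative[OF bounded_linear_Im der[of i]] by simp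
    moreover have "((\<lambda>t. 0::real) has_vector_derivative 0) (at t within {a..b})"
      by simp
    ultimately show ?thesis
      using vector_derivative_within_closed_interval[OF \<open>a < b\<close> Suc.prems(1)] by metis
  qed
  moreover have "nth_vderiv_on {a..b} (Suc k) \<gamma> t = (\<chi> i. Re (?v i))"
    using vector_derivative_within_closed_interval
      [OF \<open>a < b\<close> Suc.prems(1) has_vector_derivative_vec_lambda
        [where f = "\<lambda>i t. nth_vderiv_on {a..b} k \<gamma> t $ i", OF der_Re]]
    by simp
  ultimately show ?case
    by (simp add: complex_eq_iff)
qed

text \<open>Chain rule: the inner derivative in direction \<open>h\<close> is \<open>h\<close> times
  a fixed vector, and complex homogeneity of \<open>L\<close> pulls \<open>h\<close> out. The
  derivative of the composite is thus multiplication by one complex number.\<close>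

lemma holomorphic_several_on_compose:
  fixes F :: "complex ^ 'k \<Rightarrow> complex"
  assumes F: "holomorphic_several_on F \<Omega>" and "open U"
    and G: "\<And>p. G p holomorphic_on U"
    and sub: "\<And>z. z \<in> U \<Longrightarrow> (\<chi> p. G p z) \<in> \<Omega>"
  shows "(\<lambda>z. F (\<chi> p. G p z)) holomorphic_on U"
  unfolding holomorphic_on_def field_differentiable_def
proof
  fix z assume z: "z \<in> U"
  obtain L where L: "(F has_derivative L) (at (\<chi> p. G p z))" and hom: "\<And>c v. L (c *s v) = c * L v"
    using F sub[OF z] unfolding holomorphic_several_on_def by blast
  have "((\<lambda>w. \<chi> p. G p w) has_derivative (\<lambda>h. \<chi> p. deriv (G p) z * h)) (at z)"
    using holomorphic_derivI[OF G \<open>open U\<close> z] by (intro has_derivative_vec_lambda) (simp add: has_field_derivative_def)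
  from has_derivative_compose[OF this L]
  have "((\<lambda>w. F (\<chi> p. G p w)) has_derivative (\<lambda>h. L (\<chi> p. deriv (G p) z * h))) (at z)" .
  moreover have "(\<chi> p. deriv (G p) z * h) = h *s (\<chi> p. deriv (G p) z)" for h
    by (simp add: vec_eq_iff)
  ultimately have "((\<lambda>w. F (\<chi> p. G p w)) has_derivative (*) (L (\<chi> p. deriv (G p) z))) (at z)"
    by (simp add: hom mult.commute[of _ "L _"])
  then show "\<exists>f'. ((\<lambda>z. F (\<chi> p. G p z)) has_field_derivative f') (at z within U)"
    using has_field_derivative_at_within has_field_derivative_def by blast
qed

text \<open>A primitive \<open>P\<close> of \<open>H\<close>, suitably normalised, extends
  \<open>S\<close>. Its derivative at \<open>t0\<close> is \<open>h t0\<close>, which is nonzero, so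
  \<open>P\<close> is injective near \<open>t0\<close> and has a holomorphic inverse
  \<open>Q\<close>. The last conclusion bounds the distance of \<open>t\<close>, not of
  \<open>S t\<close>, which selects the branch of \<open>S\<close> near \<open>t0\<close>.\<close>

lemma real_primitive_holomorphic_local_inverse:
  fixes S h :: "real \<Rightarrow> real"
  assumes "convex T" "t0 \<in> T" "r > 0"
    and H: "H holomorphic_on ball (of_real t0) r"
    and Hh: "\<And>t. t \<in> T \<Longrightarrow> of_real t \<in> ball (complex_of_real t0) r \<Longrightarrow> H (of_real t) = of_real (h t)"
    and S: "\<And>t. t \<in> T \<Longrightarrow> (S has_real_derivative h t) (at t within T)"
    and "h t0 \<noteq> 0"
  obtains e Q where "e > 0" "Q holomorphic_on ball (of_real (S t0)) e"
    "Q ` ball (of_real (S t0)) e \<subseteq> ball (of_real t0) r"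
    "\<And>t. t \<in> T \<Longrightarrow> dist t t0 < e \<Longrightarrow> Q (of_real (S t)) = of_real t"
proof -
  let ?B = "ball (complex_of_real t0) r"
  obtain P0 where P0: "\<And>z. z \<in> ?B \<Longrightarrow> (P0 has_field_derivative H z) (at z within ?B)"
    using holomorphic_convex_primitive'[OF convex_ball open_ball H] by blast
  \<comment> \<open>The additive constant makes \<open>P\<close> agree with \<open>S\<close> at
    \<open>t0\<close>.\<close>
  define P where "P z = P0 z - P0 (of_real t0) + of_real (S t0)" for z
  have P: "(P has_field_derivative H z) (at z)" if "z \<in> ?B" for z
    unfolding P_def using P0[OF that] at_within_open[OF that open_ball]
    by (auto intro!: derivative_eq_intros)
  have P_S: "P (of_real t) = of_real (S t)" if t: "t \<in> T" "of_real t \<in> ?B" for t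
  proof -
    let ?V = "T \<inter> ball t0 r"
    have inB: "of_real x \<in> ?B" if "x \<in> ?V" for x
      using that by simp
    \<comment> \<open>On the convex set \<open>?V\<close> both functions have derivative
      \<open>h\<close>, so they differ by a constant, which the value at \<open>t0\<close> shows to
      be 0.\<close>
    have "\<exists>c. \<forall>x\<in>?V. P (of_real x) - of_real (S x) = c"
    proof (rule has_derivative_zero_constant)
      show "convex ?V"
        using \<open>convex T\<close> by (intro convex_Int convex_ball)
      fix x assume x: "x \<in> ?V"
      have "((\<lambda>x. P (of_real x)) has_vector_derivative H (of_real x)) (at x within ?V)"
        by (intro has_vector_derivative_real_field P inB x)
      moreover have "((\<lambda>x. complex_of_real (S x)) has_vector_derivative of_real (h x)) (at x within ?V)"
        by (intro has_vector_derivative_of_real has_field_derivative_subset[OF S]) (use x in auto)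
      ultimately have "((\<lambda>x. P (of_real x) - of_real (S x)) has_vector_derivative H (of_real x) - of_real (h x))
          (at x within ?V)"
        by (rule has_vector_derivative_diff)
      then show "((\<lambda>x. P (of_real x) - of_real (S x)) has_derivative (\<lambda>h. 0)) (at x within ?V)"
        using Hh[of x] inB[OF x] x by (simp add: has_vector_derivative_def)
    qed
    then obtain c where c: "\<And>x. x \<in> ?V \<Longrightarrow> P (of_real x) - of_real (S x) = c"
      by blast
    have "c = 0"
      using c[of t0] \<open>t0 \<in> T\<close> \<open>r > 0\<close> by (simp add: P_def)
    with c[of t] t show ?thesis
      by simp
  qed
  have holP: "P holomorphic_on ?B"
    unfolding holomorphic_on_open[OF open_ball] using P by blast
  have t0: "of_real t0 \<in> ?B"
    using \<open>r > 0\<close> by simp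
  have "deriv P (of_real t0) \<noteq> 0"
    using P[OF t0] Hh[OF \<open>t0 \<in> T\<close> t0] \<open>h t0 \<noteq> 0\<close> by (simp add: DERIV_imp_deriv)
  then obtain r' where r': "r' > 0" "ball (of_real t0) r' \<subseteq> ?B" "inj_on P (ball (of_real t0) r')"
    using has_complex_derivative_locally_injective[OF holP t0 open_ball] by blast
  let ?B' = "ball (complex_of_real t0) r'"
  have holP': "P holomorphic_on ?B'"
    using holP r'(2) by (rule holomorphic_on_subset)
  obtain Q where Q: "Q holomorphic_on P ` ?B'" "\<And>z. z \<in> ?B' \<Longrightarrow> Q (P z) = z"
    using holomorphic_has_inverse[OF holP' open_ball r'(3)] by metis
  have "open (P ` ?B')"
    by (rule open_mapping_thm3[OF holP' open_ball r'(3)])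
  moreover have "of_real (S t0) \<in> P ` ?B'"
    using P_S[OF \<open>t0 \<in> T\<close> t0] r'(1) by (metis centre_in_ball imageI)
  ultimately obtain e where e: "e > 0" "ball (of_real (S t0)) e \<subseteq> P ` ?B'"
    by (meson openE)
  show thesis
  \<comment> \<open>The bound \<open>e\<close> keeps the disc around \<open>S t0\<close> inside the
    domain of \<open>Q\<close>; the bound \<open>r'\<close> puts \<open>t\<close> into the disc
    where \<open>P\<close> is injective and \<open>Q\<close> undoes it.\<close>
  proof (rule that[of "min e r'" Q])
    show "Q holomorphic_on ball (of_real (S t0)) (min e r')"
      by (rule holomorphic_on_subset[OF Q(1)]) (use e in auto)
    show "Q ` ball (of_real (S t0)) (min e r') \<subseteq> ?B"
    proof
      fix w assume "w \<in> Q ` ball (of_real (S t0)) (min e r')"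
      then obtain z where "z \<in> ?B'" "w = Q (P z)"
        using e by auto
      then show "w \<in> ?B"
        using Q(2) r'(2) by auto
    qed
    fix t assume t: "t \<in> T" "dist t t0 < min e r'"
    then have "of_real t \<in> ?B'"
      by (simp add: dist_commute)
    moreover from this have "of_real t \<in> ?B"
      by (rule subsetD[OF r'(2)])
    ultimately show "Q (of_real (S t)) = of_real t"
      using Q(2)[of "of_real t"] P_S[OF t(1)] by simp
  qed (use e r' in auto)
qed

text \<open>The powers of \<open>s - s0\<close> are real, so taking real parts of the Taylor series
  acts on the coefficients alone. A real series results without a proof that the coefficients
  themselves are real.\<close>

lemma holomorphic_real_power_series:
  assumes "g holomorphic_on ball (of_real s0) e" "\<bar>s - s0\<bar> < e"
  shows "(\<lambda>m. (s - s0) ^ m * Re ((deriv ^^ m) g (of_real s0) / fact m)) sums Re (g (of_real s))"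
proof -
  have "of_real s \<in> ball (complex_of_real s0) e"
    using assms(2) by (simp add: dist_real_def abs_minus_commute)
  moreover define c where "c m = (deriv ^^ m) g (of_real s0) / fact m" for m
  ultimately have "(\<lambda>m. c m * (of_real s - of_real s0) ^ m) sums g (of_real s)"
    using holomorphic_power_series[OF assms(1)] by simp
  from sums_Re[OF this] show ?thesis
    unfolding c_def[symmetric] by (simp add: mult.commute flip: of_real_diff of_real_power)
qed

theorem theorem3p2:
  fixes a b :: real and N :: nat
    and \<gamma> :: "real \<Rightarrow> real ^ 'n"
    and ord :: "'m::finite \<Rightarrow> nat"
    and \<Gamma> :: "real \<Rightarrow> real ^ ('m \<times> 'n)"
    and J :: "(real ^ ('m \<times> 'n)) set"
    and \<Omega> :: "(complex ^ ('m \<times> 'n)) set"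
    and F :: "complex ^ ('m \<times> 'n) \<Rightarrow> complex"
    and S :: "real \<Rightarrow> real"
  assumes "a < b"
    and "analytic_curve_on {a..b} \<gamma>"
    and "bij_betw ord UNIV {..N}"
    and "\<And>t. t \<in> {a..b} \<Longrightarrow> \<Gamma> t = jet ord {a..b} \<gamma> t"
    and "J = \<Gamma> ` {a..b}"
    and "open \<Omega>"
    and "complexify ` J \<subseteq> \<Omega>"
    and "holomorphic_several_on F \<Omega>"
    and "F ` complexify ` J \<subseteq> complex_of_real ` {0<..}"
    and "\<And>t. t \<in> {a..b} \<Longrightarrow> S t = integral {a..t} (\<lambda>u. Re (F (complexify (\<Gamma> u))))"
  shows "\<exists>A B. A < B \<and> continuous_on {a..b} S \<and> strict_mono_on {a..b} S \<and>
           bij_betw S {a..b} {A..B} \<and>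
           analytic_curve_on {A..B} (\<gamma> \<circ> the_inv_into {a..b} S)"
proof -
  let ?I = "{a..b}"
  \<comment> \<open>On \<open>J\<close> the values of \<open>F\<close> are positive reals, so
    \<open>Re\<close> merely turns them into real numbers and \<open>h\<close> is the positive
    integrand of \<open>S\<close>.\<close>
  define h where "h t = Re (F (complexify (\<Gamma> t)))" for t
  have h: "F (complexify (\<Gamma> t)) = of_real (h t)" "h t > 0" if "t \<in> ?I" for t
    using assms(5,9) that by (force simp: h_def)+

  \<comment> \<open>Local holomorphic extension of \<open>\<gamma>\<close> and of the
    integrand\<close>
  have ext: "\<exists>r g H. r > 0 \<and> (\<forall>i. g i holomorphic_on ball (complex_of_real t0) r) \<and>
      (\<forall>i. \<forall>t\<in>?I. of_real t \<in> ball (complex_of_real t0) r \<longrightarrow> g i (of_real t) = of_real (\<gamma> t $ i)) \<and>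
      H holomorphic_on ball (of_real t0) r \<and>
      (\<forall>t\<in>?I. of_real t \<in> ball (complex_of_real t0) r \<longrightarrow> H (of_real t) = of_real (h t))"
    if t0: "t0 \<in> ?I" for t0
  proof -
    obtain r g where r: "r > 0" and g: "\<And>i. g i holomorphic_on ball (complex_of_real t0) r"
      "\<And>i t. t \<in> ?I \<Longrightarrow> of_real t \<in> ball (complex_of_real t0) r \<Longrightarrow> g i (of_real t) = of_real (\<gamma> t $ i)"
      using analytic_curve_on_complex_extension[OF assms(2) t0] by blast
    let ?B = "ball (complex_of_real t0) r"
    define G where "G p = (deriv ^^ ord (fst p)) (g (snd p))" for p :: "'m \<times> 'n"
    have G: "G p holomorphic_on ?B" for p
      unfolding G_def by (intro holomorphic_higher_deriv g open_ball)
    have G_real: "(\<chi> p. G p (of_real t)) = complexify (\<Gamma> t)" if "t \<in> ?I" "of_real t \<in> ?B" for t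
      using higher_deriv_eq_nth_vderiv_on[OF assms(1) open_ball g that] assms(4)[OF that(1)]
      by (simp add: vec_eq_iff G_def complexify_def jet_def)
    \<comment> \<open>At \<open>t0\<close> the extended jet takes the value
      \<open>complexify (\<Gamma> t0)\<close>, which lies in \<open>\<Omega>\<close>. By continuity
      it stays in this open set on a smaller disc, where \<open>F\<close> can be composed with
      it.\<close>
    have "continuous_on ?B (\<lambda>z. \<chi> p. G p z)"
      by (intro continuous_on_vec_lambda holomorphic_on_imp_continuous_on G)
    then have "open (?B \<inter> (\<lambda>z. \<chi> p. G p z) -` \<Omega>)"
      using open_ball \<open>open \<Omega>\<close> by (rule continuous_open_preimage)
    moreover have "of_real t0 \<in> ?B \<inter> (\<lambda>z. \<chi> p. G p z) -` \<Omega>"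
      using G_real[OF t0] r assms(5,7) t0 by auto
    ultimately obtain r' where r': "r' > 0" "ball (of_real t0) r' \<subseteq> ?B \<inter> (\<lambda>z. \<chi> p. G p z) -` \<Omega>"
      by (meson openE)
    define H where "H z = F (\<chi> p. G p z)" for z
    show ?thesis
    proof (intro exI[of _ r'] exI[of _ g] exI[of _ H] conjI allI ballI impI)
      show "g i holomorphic_on ball (of_real t0) r'" for i
        by (rule holomorphic_on_subset[OF g(1)]) (use r' in auto)
      show "H holomorphic_on ball (of_real t0) r'"
        unfolding H_def
        by (intro holomorphic_several_on_compose[OF assms(8) open_ball] holomorphic_on_subset[OF G])
           (use r' in auto)
      fix t assume t: "t \<in> ?I" "of_real t \<in> ball (complex_of_real t0) r'"
      then have "of_real t \<in> ?B"
        using r'(2) by blast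
      with t show "g i (of_real t) = of_real (\<gamma> t $ i)" for i
        by (intro g)
      show "H (of_real t) = of_real (h t)"
        using G_real[OF t(1) \<open>of_real t \<in> ?B\<close>] h[OF t(1)] by (simp add: H_def)
    qed fact
  qed

  \<comment> \<open>Regularity, monotonicity and inversion of \<open>S\<close>\<close>
  have cont_h: "continuous_on ?I h"
    unfolding continuous_on_eq_continuous_within
  proof
    fix t0 assume t0: "t0 \<in> ?I"
    obtain r H where r: "r > 0" and H: "H holomorphic_on ball (of_real t0) r"
      "\<And>t. t \<in> ?I \<Longrightarrow> of_real t \<in> ball (complex_of_real t0) r \<Longrightarrow> H (of_real t) = of_real (h t)"
      using ext[OF t0] by blast
    have "isCont H (of_real t0)"
      using holomorphic_on_imp_continuous_on[OF H(1)] r by (simp add: continuous_on_eq_continuous_at)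
    then have "isCont (\<lambda>t. Re (H (of_real t))) t0"
      using isCont_o2[OF linear_continuous_at[OF bounded_linear_of_real]] by (intro isCont_Re) blast
    then have "continuous (at t0 within ?I) (\<lambda>t. Re (H (of_real t)))"
      by (rule continuous_at_imp_continuous_at_within)
    then show "continuous (at t0 within ?I) h"
      by (rule continuous_transform_within[OF _ r t0]) (use H(2) in \<open>auto simp: dist_commute\<close>)
  qed
  have S: "(S has_real_derivative h t) (at t within ?I)" if "t \<in> ?I" for t
    by (rule has_field_derivative_transform_within[OF integral_has_real_derivative[OF cont_h that] zero_less_one that])
       (use assms(10) in \<open>simp add: h_def [abs_def]\<close>)
  have cont_S: "continuous_on ?I S"
    using S by (rule DERIV_continuous_on)
  have mono: "strict_mono_on ?I S"
  proof (rule strict_mono_onI)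
    fix x y assume xy: "x \<in> ?I" "y \<in> ?I" "x < y"
    show "S x < S y"
    proof (rule DERIV_pos_imp_increasing_open[OF \<open>x < y\<close>])
      \<comment> \<open>At interior points the derivative within the interval is two-sided;
        continuity of \<open>S\<close> takes care of the endpoints.\<close>
      fix z assume z: "x < z" "z < y"
      then have "at z within ?I = at z"
        using xy by (intro at_within_interior) (auto simp: interior_atLeastAtMost_real)
      with S[of z] h(2)[of z] z xy show "\<exists>D. (S has_real_derivative D) (at z) \<and> 0 < D"
        by auto
    qed (rule continuous_on_subset[OF cont_S], use xy in auto)
  qed
  have inj: "inj_on S ?I"
    using mono by (rule strict_mono_on_imp_inj_on)
  have image: "S ` ?I = {S a..S b}"
  proof
    show "S ` ?I \<subseteq> {S a..S b}"
      using strict_mono_on_imp_mono_on[OF mono] \<open>a < b\<close> by (auto simp: mono_on_def)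
    show "{S a..S b} \<subseteq> S ` ?I"
      using IVT'[of S a _ b] cont_S \<open>a < b\<close> by force
  qed
  have "S a < S b"
    using mono \<open>a < b\<close> by (auto simp: strict_mono_on_def)
  let ?\<sigma> = "the_inv_into ?I S"
  have inv: "?\<sigma> (S t) = t" if "t \<in> ?I" for t
    using inj that by (rule the_inv_into_f_f)
  \<comment> \<open>A continuous injection on a compact set has a continuous inverse. This serves
    both the derivative of the inverse and the localisation of the power series.\<close>
  have cont_inv: "continuous_on (S ` ?I) ?\<sigma>"
    by (intro continuous_on_inv_into cont_S inj compact_Icc)

  \<comment> \<open>Nonvanishing derivative of the reparametrised curve\<close>
  have der: "\<exists>v. (\<gamma> \<circ> ?\<sigma> has_vector_derivative v) (at (S t) within S ` ?I) \<and> v \<noteq> 0" if t: "t \<in> ?I" for t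
  proof -
    obtain w where w: "(\<gamma> has_vector_derivative w) (at t within ?I)" "w \<noteq> 0"
      using assms(2) t unfolding analytic_curve_on_def by blast
    have "(?\<sigma> has_derivative (\<lambda>x. x / h t)) (at (S t) within S ` ?I)"
    proof (rule has_derivative_inverse_within)
      show "(S has_derivative (*) (h t)) (at t within ?I)"
        using S[OF t] by (simp add: has_field_derivative_def)
      show "continuous (at (S t) within S ` ?I) ?\<sigma>"
        using cont_inv t by (simp add: continuous_on_eq_continuous_within)
      show "linear (\<lambda>x. x / h t)"
        by (rule linearI) (auto simp: add_divide_distrib)
      show "(\<lambda>x. x / h t) \<circ> (*) (h t) = id"
        using h(2)[OF t] by auto
    qed (use t inv in auto)
    then have "(?\<sigma> has_vector_derivative 1 / h t) (at (S t) within S ` ?I)"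
      by (simp add: has_vector_derivative_def)
    \<comment> \<open>The chain rule asks for the derivative of \<open>\<gamma>\<close> within the
      image of the inverse. That image is the whole of \<open>{a..b}\<close>, so the derivative
      \<open>w\<close> fits, also at endpoints.\<close>
    moreover have "?\<sigma> ` S ` ?I = ?I"
      using inv by force
    ultimately have "(\<gamma> \<circ> ?\<sigma> has_vector_derivative (1 / h t) *\<^sub>R w) (at (S t) within S ` ?I)"
      using w(1) t by (intro vector_diff_chain_within) (auto simp: inv)
    with w(2) h(2)[OF t] show ?thesis
      by (intro exI[of _ "(1 / h t) *\<^sub>R w"]) auto
  qed

  \<comment> \<open>Power series of the reparametrised curve\<close>
  have series: "\<exists>d>0. \<exists>c. (\<forall>s\<in>{S t0 - d<..<S t0 + d}. summable (\<lambda>m. (s - S t0) ^ m *\<^sub>R c m)) \<and>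
      (\<forall>s\<in>S ` ?I \<inter> {S t0 - d<..<S t0 + d}. (\<gamma> \<circ> ?\<sigma>) s = (\<Sum>m. (s - S t0) ^ m *\<^sub>R c m))"
    if t0: "t0 \<in> ?I" for t0
  proof -
    obtain r g H where r: "r > 0" and g: "\<And>i. g i holomorphic_on ball (complex_of_real t0) r"
      "\<And>i t. t \<in> ?I \<Longrightarrow> of_real t \<in> ball (complex_of_real t0) r \<Longrightarrow> g i (of_real t) = of_real (\<gamma> t $ i)"
      and H: "H holomorphic_on ball (of_real t0) r"
      "\<And>t. t \<in> ?I \<Longrightarrow> of_real t \<in> ball (complex_of_real t0) r \<Longrightarrow> H (of_real t) = of_real (h t)"
      using ext[OF t0] by blast
    have "h t0 \<noteq> 0"
      using h(2)[OF t0] by simp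
    obtain e Q where e: "e > 0" and Q: "Q holomorphic_on ball (of_real (S t0)) e"
      "Q ` ball (of_real (S t0)) e \<subseteq> ball (of_real t0) r"
      "\<And>t. t \<in> ?I \<Longrightarrow> dist t t0 < e \<Longrightarrow> Q (of_real (S t)) = of_real t"
      using real_primitive_holomorphic_local_inverse
        [OF convex_real_interval(5) t0 r H S \<open>h t0 \<noteq> 0\<close>] by blast
    \<comment> \<open>\<open>Q\<close> is known to invert \<open>S\<close> for \<open>t\<close> near
      \<open>t0\<close>, whereas the series concerns values near \<open>S t0\<close>; continuity of
      the inverse bridges the two. Here \<open>e\<close> serves the inversion and \<open>r\<close>
      the agreement of \<open>g\<close> with \<open>\<gamma>\<close>.\<close>
    obtain e' where e': "e' > 0"
      and near: "\<And>t. t \<in> ?I \<Longrightarrow> dist (S t) (S t0) < e' \<Longrightarrow> dist t t0 < min e r"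
    proof (rule continuous_onE[OF cont_inv imageI[OF t0]])
      show "min e r > 0"
        using e r by simp
      fix e' assume "e' > 0"
        and near: "\<And>s. s \<in> S ` ?I \<Longrightarrow> dist s (S t0) \<le> e' \<Longrightarrow> dist (?\<sigma> s) (?\<sigma> (S t0)) < min e r"
      show thesis
        using \<open>e' > 0\<close>
      proof (rule that)
        fix t assume "t \<in> ?I" "dist (S t) (S t0) < e'"
        then show "dist t t0 < min e r"
          using near[of "S t"] inv t0 by simp
      qed
    qed
    \<comment> \<open>Within \<open>e\<close> the composite \<open>K\<close> is holomorphic; within
      \<open>e'\<close> a value \<open>S t\<close> comes from a \<open>t\<close> close enough to
      \<open>t0\<close>.\<close>
    define d where "d = min e e'"
    define K where "K i = g i \<circ> Q" for i
    have K: "K i holomorphic_on ball (of_real (S t0)) d" for i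
      unfolding K_def
      by (rule holomorphic_on_compose_gen[OF _ g(1)], rule holomorphic_on_subset[OF Q(1)])
         (use Q(2) in \<open>auto simp: d_def\<close>)
    define c where "c m = (\<chi> i. Re ((deriv ^^ m) (K i) (of_real (S t0)) / fact m))" for m
    \<comment> \<open>This holds on both sides of \<open>S t0\<close>, also outside the image of
      \<open>S\<close>, as the definition of an analytic curve demands. Only the identification of
      the sum with the curve is confined to the image.\<close>
    have sums: "(\<lambda>m. (s - S t0) ^ m *\<^sub>R c m) sums (\<chi> i. Re (K i (of_real s)))"
      if "s \<in> {S t0 - d<..<S t0 + d}" for s
    proof (rule sums_vecI)
      fix i
      have "\<bar>s - S t0\<bar> < d"
        using that by auto
      from holomorphic_real_power_series[OF K this, of i]
      show "(\<lambda>m. ((s - S t0) ^ m *\<^sub>R c m) $ i) sums (\<chi> i. Re (K i (of_real s))) $ i"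
        by (simp add: c_def)
    qed
    show ?thesis
    proof (intro exI[of _ d] exI[of _ c] conjI ballI)
      show "d > 0"
        using e e' by (simp add: d_def)
      show "summable (\<lambda>m. (s - S t0) ^ m *\<^sub>R c m)" if "s \<in> {S t0 - d<..<S t0 + d}" for s
        using sums[OF that] by (rule sums_summable)
      fix s assume s: "s \<in> S ` ?I \<inter> {S t0 - d<..<S t0 + d}"
      then obtain t where t: "t \<in> ?I" "s = S t"
        by blast
      have "dist t t0 < min e r"
        using s t by (intro near) (auto simp: d_def dist_real_def)
      then have "K i (of_real s) = of_real (\<gamma> t $ i)" for i
        using Q(3)[OF t(1)] g(2)[OF t(1)] by (simp add: K_def t(2) dist_commute)
      then have "(\<chi> i. Re (K i (of_real s))) = (\<gamma> \<circ> ?\<sigma>) s"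
        by (simp add: vec_eq_iff t(2) inv[OF t(1)])
      then show "(\<gamma> \<circ> ?\<sigma>) s = (\<Sum>m. (s - S t0) ^ m *\<^sub>R c m)"
        using sums[of s] s by (simp add: sums_iff)
    qed
  qed

  \<comment> \<open>Analyticity on the image interval and conclusion\<close>
  have "analytic_curve_on (S ` ?I) (\<gamma> \<circ> ?\<sigma>)"
    unfolding analytic_curve_on_def
  proof (intro conjI)
    show "is_interval (S ` ?I)" "S ` ?I \<noteq> {}"
      using \<open>S a < S b\<close> \<open>a < b\<close> by (auto simp: image is_interval_cc)
    show "\<nexists>x. S ` ?I = {x}"
      using \<open>S a < S b\<close> unfolding image by (metis atLeastAtMost_singleton_iff less_irrefl)
      show "\<forall>s\<in>S ` ?I. \<exists>v. (\<gamma> \<circ> ?\<sigma> has_vector_derivative v) (at s within S ` ?I) \<and> v \<noteq> 0"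
      by (intro ballI, elim imageE) (simp only: der)
  qed (intro ballI, elim imageE, simp only: series)
  then show ?thesis
    using \<open>S a < S b\<close> cont_S mono inj image by (intro exI[of _ "S a"] exI[of _ "S b"]) (auto simp: bij_betw_def)
qed

end
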